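(* Let $f_1,\dots,f_m:\mathbb{M}\to\mathbb{R}$ be convex functions of class $C^1$, let $k_1,\dots,k_m\in\mathbb{R}$, and let $C=\{\sigma\in\mathbb{M} : f_i(\sigma)\le k_i,\ i=1,\dots,m\}$. Assume that there is $\sigma^\star\in\mathbb{M}$ with $f_i(\sigma^\star)<k_i$ for all $i$, and that $\sigma+pI\in C$ for all $\sigma\in C$, $p\in\mathbb{R}$. Let $\sigma\in C$ be such that $f_1(\sigma)=k_1$ and $f_i(\sigma)<k_i$ for all $i\ge2$. Then, for $\dot\varepsilon,\dot\varepsilon^{e},\dot\varepsilon^{p},\dot\sigma\in\mathbb{M}$, the constitutive laws $$\dot\varepsilon^{e}=\Pi_{T(C,\sigma)}\dot\varepsilon,\qquad \dot\varepsilon^{p}=\Pi_{N(C,\sigma)}\dot\varepsilon,\qquad \dot\sigma=\Pi_{T(C,\sigma)}\mathbb{H}(\dot\varepsilon)$$ can be rewritten as (i.e. are equivalent to) $$\dot\varepsilon^{p}=\frac{\max(0,\dot\varepsilon:\nabla f_1(\sigma))}{\|\nabla f_1(\sigma)\|^2}\nabla f_1(\sigma),\qquad \dot\varepsilon^{e}=\dot\varepsilon-\dot\varepsilon^{p},$$ $$\dot\sigma=\lambda\,\mathrm{tr}(\dot\varepsilon)I+2\mu\left(\dot\varepsilon-\frac{\max(0,\dot\varepsilon:\nabla f_1(\sigma))}{\|\nabla f_1(\sigma)\|^2}\nabla f_1(\sigma)\right).$$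
   Context: $\mathbb{M}$ is the space of real symmetric $3\times3$ matrices with scalar product $\tau:\eta=\mathrm{tr}(\tau\eta)$ and associated (Frobenius) norm $\|\cdot\|$; $I$ is the identity matrix. $\nabla f(\sigma)\in\mathbb{M}$ is the gradient of $f:\mathbb{M}\to\mathbb{R}$ with respect to this scalar product, i.e. $df(\sigma)\tau=\nabla f(\sigma):\tau$ for all $\tau\in\mathbb{M}$. The elasticity operator is $\mathbb{H}(\tau)=2\mu\tau+\lambda\,\mathrm{tr}(\tau)I$, with constants $\lambda>0$, $\mu>0$. For a nonempty convex set $K\subset\mathbb{M}$ and $\sigma\in K$, the tangent cone is $T(K,\sigma)=\overline{\{\alpha(\eta-\sigma) : \eta\in K,\ \alpha>0\}}$ and the normal cone is $N(K,\sigma)=\{\eta\in\mathbb{M} : \tau:\eta\le 0\ \forall\tau\in T(K,\sigma)\}$. $\Pi_K$ denotes the orthogonal projection onto a nonempty closed convex set $K$. Here $\dot\varepsilon,\dot\varepsilon^e,\dot\varepsilon^p,\dot\sigma$ are the strain rate, elastic strain rate, plastic strain rate and stress rate; the statement concerns them simply as elements of $\mathbb{M}$. *)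

theory Defs
  imports "HOL-Analysis.Analysis"
begin

typedef sym3 = "{A :: real^3^3. transpose A = A}"
  morphisms matrix_of Sym3
  by (rule exI[of _ "mat 1"]) simp

setup_lifting type_definition_sym3

lemma transpose_eq_self_iff: "transpose A = A \<longleftrightarrow> (\<forall>i j. A $ i $ j = A $ j $ i)"
  by (auto simp: transpose_def vec_eq_iff)

lemma trace_matrix_mult_symmetric:
  fixes A B :: "real^'n^'n"
  assumes "transpose B = B"
  shows "trace (A ** B) = A \<bullet> B"
  using assms
  by (auto simp: trace_def matrix_matrix_mult_def inner_vec_def transpose_eq_self_iff intro!: sum.cong)

instantiation sym3 :: real_inner
begin

lift_definition zero_sym3 :: sym3 is 0
  by (simp add: transpose_eq_self_iff)

lift_definition plus_sym3 :: "sym3 \<Rightarrow> sym3 \<Rightarrow> sym3" is "(+)"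
  by (simp add: transpose_eq_self_iff)

lift_definition minus_sym3 :: "sym3 \<Rightarrow> sym3 \<Rightarrow> sym3" is "(-)"
  by (simp add: transpose_eq_self_iff)

lift_definition uminus_sym3 :: "sym3 \<Rightarrow> sym3" is uminus
  by (simp add: transpose_eq_self_iff)

lift_definition scaleR_sym3 :: "real \<Rightarrow> sym3 \<Rightarrow> sym3" is "(*\<^sub>R)"
  by (simp add: transpose_eq_self_iff)

lift_definition inner_sym3 :: "sym3 \<Rightarrow> sym3 \<Rightarrow> real" is "\<lambda>A B. trace (A ** B)" .

definition norm_sym3 :: "sym3 \<Rightarrow> real" where
  "norm_sym3 \<tau> = sqrt (\<tau> \<bullet> \<tau>)"

definition dist_sym3 :: "sym3 \<Rightarrow> sym3 \<Rightarrow> real" where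
  "dist_sym3 \<sigma> \<tau> = norm (\<sigma> - \<tau>)"

definition sgn_sym3 :: "sym3 \<Rightarrow> sym3" where
  "sgn_sym3 \<tau> = inverse (norm \<tau>) *\<^sub>R \<tau>"

definition uniformity_sym3 :: "(sym3 \<times> sym3) filter" where
  "uniformity_sym3 = (INF e\<in>{0<..}. principal {(x, y). dist x y < e})"

definition open_sym3 :: "sym3 set \<Rightarrow> bool" where
  "open_sym3 U \<longleftrightarrow> (\<forall>x\<in>U. \<forall>\<^sub>F (x', y) in uniformity. x' = x \<longrightarrow> y \<in> U)"

instance
proof
  fix \<rho> \<sigma> \<tau> :: sym3 and a b :: real and U :: "sym3 set"
  show "\<rho> + \<sigma> + \<tau> = \<rho> + (\<sigma> + \<tau>)" by transfer simp
  show "\<rho> + \<sigma> = \<sigma> + \<rho>" by transfer simp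
  show "0 + \<rho> = \<rho>" by transfer simp
  show "- \<rho> + \<rho> = 0" by transfer simp
  show "\<rho> - \<sigma> = \<rho> + - \<sigma>" by transfer simp
  show "a *\<^sub>R (\<rho> + \<sigma>) = a *\<^sub>R \<rho> + a *\<^sub>R \<sigma>" by transfer (simp add: scaleR_add_right)
  show "(a + b) *\<^sub>R \<rho> = a *\<^sub>R \<rho> + b *\<^sub>R \<rho>" by transfer (simp add: scaleR_add_left)
  show "a *\<^sub>R b *\<^sub>R \<rho> = (a * b) *\<^sub>R \<rho>" by transfer simp
  show "1 *\<^sub>R \<rho> = \<rho>" by transfer simp
  show "dist \<rho> \<sigma> = norm (\<rho> - \<sigma>)" by (rule dist_sym3_def)
  show "sgn \<rho> = inverse (norm \<rho>) *\<^sub>R \<rho>" by (rule sgn_sym3_def)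
  show "(uniformity :: (sym3 \<times> sym3) filter) = (INF e\<in>{0<..}. principal {(x, y). dist x y < e})"
    by (rule uniformity_sym3_def)
  show "open U \<longleftrightarrow> (\<forall>x\<in>U. \<forall>\<^sub>F (x', y) in uniformity. x' = x \<longrightarrow> y \<in> U)"
    by (rule open_sym3_def)
  show "\<rho> \<bullet> \<sigma> = \<sigma> \<bullet> \<rho>"
    by transfer (simp add: trace_matrix_mult_symmetric inner_commute)
  show "(\<rho> + \<sigma>) \<bullet> \<tau> = \<rho> \<bullet> \<tau> + \<sigma> \<bullet> \<tau>"
    by transfer (simp add: trace_matrix_mult_symmetric inner_add_left)
  show "(a *\<^sub>R \<rho>) \<bullet> \<sigma> = a * (\<rho> \<bullet> \<sigma>)"
    by transfer (simp add: trace_matrix_mult_symmetric)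
  show "0 \<le> \<rho> \<bullet> \<rho>"
    by transfer (simp add: trace_matrix_mult_symmetric)
  show "\<rho> \<bullet> \<rho> = 0 \<longleftrightarrow> \<rho> = 0"
    by transfer (simp add: trace_matrix_mult_symmetric)
  show "norm \<rho> = sqrt (\<rho> \<bullet> \<rho>)" by (rule norm_sym3_def)
qed

end

lemma inner_sym3_eq: "\<sigma> \<bullet> \<tau> = matrix_of \<sigma> \<bullet> matrix_of \<tau>"
  by transfer (simp add: trace_matrix_mult_symmetric)

lemma norm_sym3_eq: "norm \<tau> = norm (matrix_of \<tau>)"
  by (simp add: norm_eq_sqrt_inner inner_sym3_eq)

lemma ex_orthonormal_basis_sym3:
  "\<exists>B :: sym3 set. finite B \<and> (\<forall>u\<in>B. \<forall>v\<in>B. u \<bullet> v = (if u = v then 1 else 0)) \<and>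
    (\<forall>x. (\<forall>u\<in>B. x \<bullet> u = 0) \<longleftrightarrow> x = 0)"
proof -
  let ?S = "{A :: real^3^3. transpose A = A}"
  have S: "subspace ?S"
    by (auto simp: subspace_def transpose_eq_self_iff)
  obtain B where B: "B \<subseteq> ?S" "pairwise orthogonal B" "\<And>x. x \<in> B \<Longrightarrow> norm x = 1"
      "independent B" "card B = dim ?S" "span B = ?S"
    using orthonormal_basis_subspace[OF S] by blast
  have fin: "finite B"
    using B(4) independent_imp_finite by blast
  have m: "matrix_of (Sym3 u) = u" if "u \<in> B" for u
    using that B(1) Sym3_inverse by blast
  have on: "u \<bullet> v = (if u = v then 1 else 0)" if "u \<in> Sym3 ` B" "v \<in> Sym3 ` B" for u v
  proof -
    obtain a b where ab: "a \<in> B" "b \<in> B" "u = Sym3 a" "v = Sym3 b"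
      using \<open>u \<in> Sym3 ` B\<close> \<open>v \<in> Sym3 ` B\<close> by blast
    have "a \<bullet> b = (if a = b then 1 else 0)"
      using B(2,3) ab(1,2) by (auto simp: pairwise_def orthogonal_def norm_eq_1)
    moreover have "u = v \<longleftrightarrow> a = b"
      using ab m by metis
    ultimately show ?thesis
      using ab m by (simp add: inner_sym3_eq)
  qed
  have zero: "x = 0" if "\<forall>u\<in>Sym3 ` B. x \<bullet> u = 0" for x
  proof -
    have "orthogonal (matrix_of x) b" if "b \<in> B" for b
      using \<open>\<forall>u\<in>Sym3 ` B. x \<bullet> u = 0\<close> m[OF that] that
      by (auto simp: inner_sym3_eq orthogonal_def)
    moreover have "matrix_of x \<in> span B"
      using B(6) matrix_of by simp
    ultimately have "orthogonal (matrix_of x) (matrix_of x)"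
      using orthogonal_to_span by blast
    then have "x \<bullet> x = 0"
      by (simp add: inner_sym3_eq orthogonal_def)
    then show ?thesis by simp
  qed
  show ?thesis
    using fin on zero by (intro exI[of _ "Sym3 ` B"]) auto
qed

instantiation sym3 :: euclidean_space
begin

text \<open>Only the existence of an orthonormal basis matters, so an arbitrary one is chosen.\<close>

definition Basis_sym3 :: "sym3 set" where
  "Basis_sym3 = (SOME B. finite B \<and> (\<forall>u\<in>B. \<forall>v\<in>B. u \<bullet> v = (if u = v then 1 else 0)) \<and>
    (\<forall>x. (\<forall>u\<in>B. x \<bullet> u = 0) \<longleftrightarrow> x = 0))"

instance
proof
  note * = someI_ex[OF ex_orthonormal_basis_sym3, folded Basis_sym3_def]
  show "finite (Basis :: sym3 set)" using * by blast
  show "u \<bullet> v = (if u = v then 1 else 0)" if "u \<in> Basis" "v \<in> Basis" for u v :: sym3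
    using * that by blast
  show iff: "(\<forall>u\<in>Basis. x \<bullet> u = 0) \<longleftrightarrow> x = 0" for x :: sym3
    using * by blast
  have "Sym3 (mat 1) \<noteq> 0"
  proof
    assume "Sym3 (mat 1) = 0"
    then have "matrix_of (Sym3 (mat 1)) = 0" by (simp add: zero_sym3.rep_eq)
    moreover have "matrix_of (Sym3 (mat 1)) = mat 1" by (simp add: Sym3_inverse)
    ultimately have "(mat 1 :: real^3^3) $ 1 $ 1 = 0" by simp
    then show False by (simp add: mat_def)
  qed
  then show "(Basis :: sym3 set) \<noteq> {}" using iff by blast
qed

end

lift_definition tr :: "sym3 \<Rightarrow> real" is trace .

lift_definition id3 :: sym3 is "mat 1"
  by simp

definition elasticity :: "real \<Rightarrow> real \<Rightarrow> sym3 \<Rightarrow> sym3" where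
  "elasticity lam mu \<tau> = (2 * mu) *\<^sub>R \<tau> + (lam * tr \<tau>) *\<^sub>R id3"

definition class_C1 :: "('a::real_normed_vector \<Rightarrow> real) \<Rightarrow> bool" where
  "class_C1 f \<longleftrightarrow> (\<exists>f' :: 'a \<Rightarrow> 'a \<Rightarrow>\<^sub>L real.
     (\<forall>x. (f has_derivative blinfun_apply (f' x)) (at x)) \<and> continuous_on UNIV f')"

text \<open>The Riesz representative of the derivative; \<^term>\<open>GDERIV f x :> g\<close> says that the derivative
  of \<open>f\<close> at \<open>x\<close> is \<open>\<lambda>\<tau>. \<tau> \<bullet> g\<close>. The value is unspecified where \<open>f\<close> is not differentiable.\<close>

definition gradient :: "('a::real_inner \<Rightarrow> real) \<Rightarrow> 'a \<Rightarrow> 'a" where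
  "gradient f x = (THE g. GDERIV f x :> g)"

lemma gradient_eqI:
  assumes "GDERIV f x :> g"
  shows "gradient f x = g"
proof -
  have "h = g" if "GDERIV f x :> h" for h
  proof -
    have "(\<lambda>\<tau>. \<tau> \<bullet> h) = (\<lambda>\<tau>. \<tau> \<bullet> g)"
      using assms that unfolding gderiv_def by (rule has_derivative_unique[rotated])
    then have "(h - g) \<bullet> (h - g) = 0"
      by (simp add: fun_eq_iff inner_diff_right)
    then show ?thesis by simp
  qed
  then show ?thesis
    unfolding gradient_def using assms by blast
qed

lemma class_C1_imp_GDERIV:
  fixes f :: "'a::euclidean_space \<Rightarrow> real"
  assumes "class_C1 f"
  shows "GDERIV f x :> gradient f x"
proof -
  obtain f' where f': "(f has_derivative f') (at x)"
    using assms unfolding class_C1_def by blast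
  then have "linear f'"
    by (rule has_derivative_linear)
  then have "GDERIV f x :> adjoint f' 1"
    using f' adjoint_works[OF \<open>linear f'\<close>, of _ 1] by (simp add: gderiv_def)
  then show ?thesis
    by (simp add: gradient_eqI)
qed

definition tangent_cone :: "'a::real_normed_vector set \<Rightarrow> 'a \<Rightarrow> 'a set" where
  "tangent_cone K \<sigma> = closure {\<alpha> *\<^sub>R (\<eta> - \<sigma>) |\<alpha> \<eta>. \<eta> \<in> K \<and> \<alpha> > 0}"

definition normal_cone :: "'a::real_inner set \<Rightarrow> 'a \<Rightarrow> 'a set" where
  "normal_cone K \<sigma> = {\<eta>. \<forall>\<tau>\<in>tangent_cone K \<sigma>. \<tau> \<bullet> \<eta> \<le> 0}"

end

theory Submission
  imports Defs
begin

text \<open>Since only \<open>f 1\<close> is active at \<open>\<sigma>\<close> and Slater's condition together with convexity forces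
  \<open>g = gradient (f 1) \<sigma>\<close> to be nonzero, the tangent cone is the half-space \<open>\<tau> \<bullet> g \<le> 0\<close>
  and the normal cone is the ray spanned by \<open>g\<close>; projections onto both are explicit.
  Invariance of \<open>C\<close> under \<open>\<tau> \<mapsto> \<tau> + p I\<close> puts \<open>\<plusminus>I\<close> into the tangent cone, so \<open>I\<close> is orthogonal
  to \<open>g\<close>: the volumetric part of the elasticity operator is unaffected by the projection, which
  commutes with the positive scaling \<open>2 \<mu>\<close> of the rest.\<close>

lemma GDERIV_along_line:
  fixes f :: "'a::real_inner \<Rightarrow> real"
  assumes "GDERIV f x :> g"
  shows "((\<lambda>t. f (x + t *\<^sub>R v)) has_real_derivative v \<bullet> g) (at 0)"
proof -
  have "((\<lambda>t. x + t *\<^sub>R v) has_derivative (\<lambda>t. t *\<^sub>R v)) (at (0::real))"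
    by (auto intro!: derivative_eq_intros)
  moreover have "(f has_derivative (\<lambda>\<tau>. \<tau> \<bullet> g)) (at (x + 0 *\<^sub>R v))"
    using assms by (simp add: gderiv_def)
  ultimately have "((\<lambda>t. f (x + t *\<^sub>R v)) has_derivative (\<lambda>t. (t *\<^sub>R v) \<bullet> g)) (at (0::real))"
    by (rule has_derivative_compose)
  moreover have "(\<lambda>t. (t *\<^sub>R v) \<bullet> g) = (*) (v \<bullet> g)"
    by (auto simp: fun_eq_iff)
  ultimately show ?thesis
    by (simp add: has_field_derivative_def)
qed

text \<open>Restricting \<open>f\<close> to the line through \<open>x\<close> and \<open>y\<close>
  reduces this to one variable: a convex function on the reals lies above its tangent at 0, and
  evaluating at 1 gives the claim.\<close>

lemma convex_on_gradient_inequality: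
  fixes f :: "'a::real_inner \<Rightarrow> real"
  assumes "convex_on UNIV f" and g: "GDERIV f x :> g"
  shows "(y - x) \<bullet> g \<le> f y - f x"
proof -
  define h where "h t = x + t *\<^sub>R (y - x)" for t :: real
  have h_combine: "h ((1 - t) * a + t * b) = (1 - t) *\<^sub>R h a + t *\<^sub>R h b" for t a b
    by (simp add: h_def algebra_simps)
  have "convex_on UNIV (\<lambda>t. f (h t))"
    using convex_onD[OF assms(1)] by (intro convex_onI) (auto simp: h_combine)
  moreover have "((\<lambda>t. f (h t)) has_real_derivative (y - x) \<bullet> g) (at 0)"
    unfolding h_def by (rule GDERIV_along_line[OF g])
  ultimately have "f (h 1) - f (h 0) \<ge> (y - x) \<bullet> g * (1 - 0)"
    by (intro convex_on_imp_above_tangent[where A = UNIV]) auto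
  then show ?thesis
    by (simp add: h_def)
qed

lemma eventually_less_along_descent_direction:
  fixes f :: "'a::real_inner \<Rightarrow> real"
  assumes "GDERIV f x :> g" and "v \<bullet> g < 0"
  shows "\<forall>\<^sub>F t in at_right 0. f (x + t *\<^sub>R v) < f x"
proof -
  from has_real_derivative_neg_dec_right[OF GDERIV_along_line[OF assms(1)] assms(2)]
  obtain d where "d > 0" "\<And>t. 0 < t \<Longrightarrow> t < d \<Longrightarrow> f (x + t *\<^sub>R v) < f x"
    by auto
  then show ?thesis
    unfolding eventually_at_right_field by auto
qed

text \<open>The gradient inequality gives each generator \<open>\<eta> - \<sigma>\<close> a
  nonpositive product with \<open>g\<close>; positive scaling keeps the sign, and the closed
  half-space absorbs the closure.\<close>

lemma tangent_cone_subset_halfspace: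
  fixes f :: "'a::real_inner \<Rightarrow> real"
  assumes "convex_on UNIV f" "GDERIV f \<sigma> :> g" "K \<subseteq> {\<tau>. f \<tau> \<le> f \<sigma>}"
  shows "tangent_cone K \<sigma> \<subseteq> {\<tau>. \<tau> \<bullet> g \<le> 0}"
  unfolding tangent_cone_def
proof (rule closure_minimal)
  have "(\<alpha> *\<^sub>R (\<eta> - \<sigma>)) \<bullet> g \<le> 0" if "\<eta> \<in> K" "\<alpha> > 0" for \<alpha> \<eta>
  proof -
    have "(\<eta> - \<sigma>) \<bullet> g \<le> 0"
      using convex_on_gradient_inequality[OF assms(1,2), of \<eta>] that assms(3) by fastforce
    then show ?thesis
      using that by (simp add: mult_le_0_iff)
  qed
  then show "{\<alpha> *\<^sub>R (\<eta> - \<sigma>) |\<alpha> \<eta>. \<eta> \<in> K \<and> \<alpha> > 0} \<subseteq> {\<tau>. \<tau> \<bullet> g \<le> 0}"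
    by auto
  show "closed {\<tau>. \<tau> \<bullet> g \<le> 0}"
    by (intro closed_Collect_le continuous_intros)
qed

text \<open>A single \<open>t > 0\<close> with \<open>\<sigma> + t *\<^sub>R \<tau>\<close> in
  \<open>K\<close> makes \<open>\<tau>\<close> itself a generator, with scaling factor
  \<open>1 / t\<close>.\<close>

lemma feasible_direction_in_tangent_cone:
  assumes "\<forall>\<^sub>F t in at_right 0. \<sigma> + t *\<^sub>R \<tau> \<in> K"
  shows "\<tau> \<in> tangent_cone K \<sigma>"
proof -
  obtain b :: real where b: "b > 0" "\<And>t. 0 < t \<Longrightarrow> t < b \<Longrightarrow> \<sigma> + t *\<^sub>R \<tau> \<in> K"
    using assms unfolding eventually_at_right_field by auto
  define t where "t = b / 2"
  have t: "t > 0" "\<sigma> + t *\<^sub>R \<tau> \<in> K"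
    using b by (auto simp: t_def)
  show ?thesis
    unfolding tangent_cone_def
  proof (rule subsetD[OF closure_subset], intro CollectI exI conjI)
    show "\<tau> = (1 / t) *\<^sub>R ((\<sigma> + t *\<^sub>R \<tau>) - \<sigma>)" "1 / t > 0"
      using t by simp_all
  qed (rule t)
qed

text \<open>The active constraint alone confines the cone to the half-space. Conversely, a strict
  descent direction of \<open>f a\<close> is feasible: \<open>f a\<close> decreases along it at
  first, and the finitely many other constraints stay strict by continuity.\<close>

lemma tangent_cone_sublevel_single_active:
  fixes f :: "'i \<Rightarrow> 'a::euclidean_space \<Rightarrow> real"
  assumes "finite J" and "a \<in> J"
    and "convex_on UNIV (f a)" and g: "GDERIV (f a) \<sigma> :> g" and "g \<noteq> 0"
    and cont: "\<And>i. i \<in> J \<Longrightarrow> isCont (f i) \<sigma>"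
    and "f a \<sigma> = k a" and inactive: "\<And>i. i \<in> J \<Longrightarrow> i \<noteq> a \<Longrightarrow> f i \<sigma> < k i"
  shows "tangent_cone {\<tau>. \<forall>i\<in>J. f i \<tau> \<le> k i} \<sigma> = {\<tau>. \<tau> \<bullet> g \<le> 0}"
    (is "tangent_cone ?C \<sigma> = _")
proof (rule subset_antisym)
  show "tangent_cone ?C \<sigma> \<subseteq> {\<tau>. \<tau> \<bullet> g \<le> 0}"
    by (rule tangent_cone_subset_halfspace[of "f a"]) (use assms in auto)
  have "\<tau> \<in> tangent_cone ?C \<sigma>" if "\<tau> \<bullet> g < 0" for \<tau>
  proof (rule feasible_direction_in_tangent_cone)
    have "\<forall>\<^sub>F t in at_right 0. f i (\<sigma> + t *\<^sub>R \<tau>) \<le> k i" if "i \<in> J" for i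
    proof (cases "i = a")
      case True
      show ?thesis
        using eventually_less_along_descent_direction[OF g \<open>\<tau> \<bullet> g < 0\<close>]
        by (rule eventually_mono) (simp add: True \<open>f a \<sigma> = k a\<close>)
    next
      case False
      have "((\<lambda>t. \<sigma> + t *\<^sub>R \<tau>) \<longlongrightarrow> \<sigma> + 0 *\<^sub>R \<tau>) (at_right (0::real))"
        by (intro tendsto_intros)
      then have "((\<lambda>t. f i (\<sigma> + t *\<^sub>R \<tau>)) \<longlongrightarrow> f i \<sigma>) (at_right (0::real))"
        using isCont_tendsto_compose[OF cont[OF that]] by simp
      from order_tendstoD(2)[OF this inactive[OF that False]]
      show ?thesis
        by (rule eventually_mono) simp
    qed
    then show "\<forall>\<^sub>F t in at_right 0. \<sigma> + t *\<^sub>R \<tau> \<in> ?C"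
      using \<open>finite J\<close> by (simp add: eventually_ball_finite)
  qed
  \<comment> \<open>Directions orthogonal to \<open>g\<close> may leave the set at once, so they are
    obtained only as limits of strict descent directions; this uses that the tangent cone is closed
    and that \<open>g\<close> is nonzero.\<close>
  then have "closure {\<tau>. g \<bullet> \<tau> < 0} \<subseteq> tangent_cone ?C \<sigma>"
    unfolding inner_commute[of g] by (intro closure_minimal) (auto simp: tangent_cone_def)
  then show "{\<tau>. \<tau> \<bullet> g \<le> 0} \<subseteq> tangent_cone ?C \<sigma>"
    unfolding closure_halfspace_lt[OF \<open>g \<noteq> 0\<close>] by (simp add: inner_commute)
qed

lemma normal_cone_of_halfspace_tangent_cone:
  assumes T: "tangent_cone K \<sigma> = {\<tau>. \<tau> \<bullet> g \<le> 0}" and "g \<noteq> 0"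
  shows "normal_cone K \<sigma> = {c *\<^sub>R g |c. c \<ge> 0}"
proof (rule subset_antisym)
  show "{c *\<^sub>R g |c. c \<ge> 0} \<subseteq> normal_cone K \<sigma>"
    by (auto simp: normal_cone_def T mult_le_0_iff)
  show "normal_cone K \<sigma> \<subseteq> {c *\<^sub>R g |c. c \<ge> 0}"
  proof
    fix \<eta> assume "\<eta> \<in> normal_cone K \<sigma>"
    then have *: "\<tau> \<bullet> \<eta> \<le> 0" if "\<tau> \<bullet> g \<le> 0" for \<tau>
      using that by (auto simp: normal_cone_def T)
    \<comment> \<open>\<open>c *\<^sub>R g\<close> is the orthogonal projection of
      \<open>\<eta>\<close> onto the line of \<open>g\<close>. The residual is orthogonal to
      \<open>g\<close>, hence a tangent direction, and testing \<open>\<eta>\<close> against it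
      bounds its own squared norm by 0.\<close>
    define c where "c = (\<eta> \<bullet> g) / (g \<bullet> g)"
    have gg: "g \<bullet> g > 0"
      using \<open>g \<noteq> 0\<close> by simp
    have orth: "(\<eta> - c *\<^sub>R g) \<bullet> g = 0"
      using gg by (simp add: c_def inner_diff_left)
    have "(\<eta> - c *\<^sub>R g) \<bullet> (\<eta> - c *\<^sub>R g) = (\<eta> - c *\<^sub>R g) \<bullet> \<eta> - c * ((\<eta> - c *\<^sub>R g) \<bullet> g)"
      by (simp add: inner_diff_right)
    then have "(\<eta> - c *\<^sub>R g) \<bullet> (\<eta> - c *\<^sub>R g) \<le> 0"
      using *[of "\<eta> - c *\<^sub>R g"] orth by simp
    then have "\<eta> = c *\<^sub>R g"
      by (metis eq_iff_diff_eq_0 inner_ge_zero inner_eq_zero_iff order_antisym)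
    \<comment> \<open>The direction \<open>- g\<close> lies in the half-space and detects the sign
      of \<open>c\<close>.\<close>
    moreover have "c \<ge> 0"
      using *[of "- g"] gg by (simp add: c_def inner_commute)
    ultimately show "\<eta> \<in> {c *\<^sub>R g |c. c \<ge> 0}"
      by blast
  qed
qed

text \<open>The variational inequality characterizes the projection: expanding the square of
  \<open>a - z = (a - x) - (z - x)\<close>, the cross term can only increase the distance.\<close>

lemma closest_point_eqI:
  fixes x :: "'a::euclidean_space"
  assumes "convex S" "closed S" "x \<in> S" and obtuse: "\<And>z. z \<in> S \<Longrightarrow> (a - x) \<bullet> (z - x) \<le> 0"
  shows "closest_point S a = x"
proof (rule closest_point_unique[OF assms(1-3), symmetric], intro ballI)
  fix z assume "z \<in> S"
  have "(norm (a - z))\<^sup>2 = (norm (a - x))\<^sup>2 - 2 * ((a - x) \<bullet> (z - x)) + (norm (z - x))\<^sup>2"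
    by (simp add: power2_norm_eq_inner algebra_simps inner_commute)
  then have "(norm (a - x))\<^sup>2 \<le> (norm (a - z))\<^sup>2"
    using obtuse[OF \<open>z \<in> S\<close>] zero_le_power2[of "norm (z - x)"] by linarith
  then show "dist a x \<le> dist a z"
    by (simp add: dist_norm)
qed

text \<open>This is the Moreau decomposition of \<open>x\<close> for a half-space and its polar ray:
  \<open>x - P x\<close> and \<open>P x\<close> are orthogonal and lie in the two cones.
  Orthogonality reduces each variational inequality to a sign condition between polar
  elements.\<close>

lemma
  fixes g :: "'a::euclidean_space"
  assumes "g \<noteq> 0"
  defines "P \<equiv> \<lambda>x. (max 0 (x \<bullet> g) / (norm g)\<^sup>2) *\<^sub>R g"
  shows closest_point_halfspace: "closest_point {\<tau>. \<tau> \<bullet> g \<le> 0} x = x - P x"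
    and closest_point_ray: "closest_point {c *\<^sub>R g |c. c \<ge> 0} x = P x"
proof -
  have P_inner: "P x \<bullet> g = max 0 (x \<bullet> g)"
    using assms(1) by (simp add: P_def power2_norm_eq_inner)
  \<comment> \<open>Either \<open>x \<bullet> g \<le> 0\<close> and \<open>P x\<close> vanishes, or
    \<open>P x \<bullet> g = x \<bullet> g\<close> and the residual is orthogonal to
    \<open>g\<close>.\<close>
  have orth: "P x \<bullet> (x - P x) = 0"
    using P_inner by (auto simp: P_def inner_diff_right inner_commute max_def)
  show "closest_point {\<tau>. \<tau> \<bullet> g \<le> 0} x = x - P x"
  proof (rule closest_point_eqI)
    show "convex {\<tau>. \<tau> \<bullet> g \<le> 0}"
      using convex_halfspace_le[of g 0] by (simp add: inner_commute)
    show "closed {\<tau>. \<tau> \<bullet> g \<le> 0}"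
      by (intro closed_Collect_le continuous_intros)
    show "x - P x \<in> {\<tau>. \<tau> \<bullet> g \<le> 0}"
      using P_inner by (simp add: inner_diff_left)
    fix z assume "z \<in> {\<tau>. \<tau> \<bullet> g \<le> 0}"
    then have "P x \<bullet> z \<le> 0"
      by (simp add: P_def inner_commute divide_nonpos_nonneg mult_nonneg_nonpos)
    then show "(x - (x - P x)) \<bullet> (z - (x - P x)) \<le> 0"
      using orth by (simp add: inner_diff_right)
  qed
  show "closest_point {c *\<^sub>R g |c. c \<ge> 0} x = P x"
  proof (rule closest_point_eqI)
    have image: "{c *\<^sub>R g |c. c \<ge> 0} = (\<lambda>c. c *\<^sub>R g) ` {0..}"
      by auto
    show "convex {c *\<^sub>R g |c. c \<ge> 0}"
      unfolding image by (intro convex_linear_image) (auto intro!: linearI simp: algebra_simps)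
    show "closed {c *\<^sub>R g |c. c \<ge> 0}"
      unfolding image using assms(1)
      by (intro closed_injective_linear_image) (auto intro!: linearI injI simp: algebra_simps)
    show "P x \<in> {c *\<^sub>R g |c. c \<ge> 0}"
      unfolding image P_def by (rule imageI) simp
    fix z assume "z \<in> {c *\<^sub>R g |c. c \<ge> 0}"
    then obtain c where z: "z = c *\<^sub>R g" "c \<ge> 0"
      by blast
    have "(x - P x) \<bullet> z \<le> 0"
      using z P_inner by (simp add: inner_diff_left mult_nonneg_nonpos)
    then show "(x - P x) \<bullet> (z - P x) \<le> 0"
      using orth by (simp add: inner_diff_right inner_commute)
  qed
qed

theorem theorem3p1:
  fixes lam mu :: real
    and m :: nat
    and f :: "nat \<Rightarrow> sym3 \<Rightarrow> real"
    and k :: "nat \<Rightarrow> real"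
    and C :: "sym3 set"
    and \<sigma> eps eps_e eps_p sig :: sym3
  assumes "lam > 0" and "mu > 0"
    and "m \<ge> 1"
    and "\<And>i. i \<in> {1..m} \<Longrightarrow> convex_on UNIV (f i)"
    and "\<And>i. i \<in> {1..m} \<Longrightarrow> class_C1 (f i)"
    and "C = {\<tau>. \<forall>i\<in>{1..m}. f i \<tau> \<le> k i}"
    and "\<exists>\<sigma>'. \<forall>i\<in>{1..m}. f i \<sigma>' < k i"
    and "\<And>\<tau> p. \<tau> \<in> C \<Longrightarrow> \<tau> + p *\<^sub>R id3 \<in> C"
    and "\<sigma> \<in> C"
    and "f 1 \<sigma> = k 1"
    and "\<And>i. i \<in> {2..m} \<Longrightarrow> f i \<sigma> < k i"
  shows "(eps_e = closest_point (tangent_cone C \<sigma>) eps \<and>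
          eps_p = closest_point (normal_cone C \<sigma>) eps \<and>
          sig = closest_point (tangent_cone C \<sigma>) (elasticity lam mu eps))
     \<longleftrightarrow>
         (eps_p = (max 0 (eps \<bullet> gradient (f 1) \<sigma>) / (norm (gradient (f 1) \<sigma>))\<^sup>2)
                    *\<^sub>R gradient (f 1) \<sigma> \<and>
          eps_e = eps - eps_p \<and>
          sig = (lam * tr eps) *\<^sub>R id3 +
                (2 * mu) *\<^sub>R (eps - (max 0 (eps \<bullet> gradient (f 1) \<sigma>)
                    / (norm (gradient (f 1) \<sigma>))\<^sup>2) *\<^sub>R gradient (f 1) \<sigma>))"
proof -
  define g where "g = gradient (f 1) \<sigma>"
  have deriv: "GDERIV (f i) \<sigma> :> gradient (f i) \<sigma>" if "i \<in> {1..m}" for i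
    using that assms(5) by (intro class_C1_imp_GDERIV)
  have one: "1 \<in> {1..m}"
    using \<open>m \<ge> 1\<close> by simp
  have g: "GDERIV (f 1) \<sigma> :> g"
    using deriv[OF one] by (simp add: g_def)
  have "g \<noteq> 0"
  proof -
    obtain \<sigma>' where "f 1 \<sigma>' < k 1"
      using assms(7) one by blast
    then have "(\<sigma>' - \<sigma>) \<bullet> g < 0"
      using convex_on_gradient_inequality[OF assms(4)[OF one] g, of \<sigma>'] assms(10) by linarith
    then show ?thesis
      by auto
  qed
  have T: "tangent_cone C \<sigma> = {\<tau>. \<tau> \<bullet> g \<le> 0}"
    unfolding assms(6)
  proof (rule tangent_cone_sublevel_single_active[where f = f and k = k, OF _ one assms(4)[OF one] g \<open>g \<noteq> 0\<close>])
    show "isCont (f i) \<sigma>" if "i \<in> {1..m}" for i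
      using deriv[OF that] unfolding gderiv_def by (rule has_derivative_continuous)
    show "f i \<sigma> < k i" if "i \<in> {1..m}" "i \<noteq> 1" for i
      using that assms(11) by simp
  qed (use assms(10) in auto)
  have N: "normal_cone C \<sigma> = {c *\<^sub>R g |c. c \<ge> 0}"
    by (rule normal_cone_of_halfspace_tangent_cone[OF T \<open>g \<noteq> 0\<close>])
  \<comment> \<open>Moving by \<open>t\<close> along \<open>p *\<^sub>R id3\<close> is the
    admissible shift by \<open>t * p\<close>, so this direction is feasible for every
    \<open>t\<close>.\<close>
  have "p *\<^sub>R id3 \<in> tangent_cone C \<sigma>" for p
    by (rule feasible_direction_in_tangent_cone) (simp add: assms(8,9))
  from this[of 1] this[of "-1"] have "id3 \<bullet> g = 0"
    by (simp add: T)
  then have "elasticity lam mu eps \<bullet> g = 2 * mu * (eps \<bullet> g)"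
    by (simp add: elasticity_def inner_add_left)
  \<comment> \<open>Positive homogeneity of the positive part, with the factor
    \<open>2 * mu > 0\<close>.\<close>
  then have "max 0 (elasticity lam mu eps \<bullet> g) = 2 * mu * max 0 (eps \<bullet> g)"
    using \<open>mu > 0\<close> by (auto simp: max_def mult_le_0_iff zero_le_mult_iff)
  then have "closest_point (tangent_cone C \<sigma>) (elasticity lam mu eps) =
      (lam * tr eps) *\<^sub>R id3 + (2 * mu) *\<^sub>R (eps - (max 0 (eps \<bullet> g) / (norm g)\<^sup>2) *\<^sub>R g)"
    by (simp add: T closest_point_halfspace[OF \<open>g \<noteq> 0\<close>] elasticity_def algebra_simps)
  \<comment> \<open>With explicit projections both sides prescribe the same three values;
    \<open>eps_e = eps - eps_p\<close> matches because the two projections of \<open>eps\<close> sum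
    to \<open>eps\<close>.\<close>
  then show ?thesis
    unfolding g_def[symmetric] T N
    by (auto simp: closest_point_halfspace[OF \<open>g \<noteq> 0\<close>] closest_point_ray[OF \<open>g \<noteq> 0\<close>])
qed

end
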